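(* For each integer $n\ge2$, let $$P_{x,y,z}(T)=\bigl((-1)^nxT^{n-1}+(-1)^ny\bigr)(1+T)^{n-1}-T^{n-1}z .$$ The discriminant $\mathrm{disc}_T(P_{x,y,z}(T))$ of this polynomial with respect to the variable $T$, which is a polynomial of degree $4n-6$ in $x,y,z$, is related to the polynomial $p_n(z;x,y)$ by $$(-1)^n(n-1)^{2n-2}(xyz)^{n-2}\,p_n(z;x,y)=\mathrm{disc}_T\bigl(P_{x,y,z}(T)\bigr).$$ Equivalently, the polynomial $\mathrm{disc}(P_{x,y,z})$ is defined as the discriminant (in the sense of Gelfand–Kapranov–Zelevinsky, for homogeneous polynomials) of the homogenized polynomial $$(u+v)^{n-1}(xu^{n-1}+yv^{n-1})-(uv)^{n-1}z$$ with respect to the variables $u$ and $v$.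
   Context: $p_n(z;x,y)=\prod_{r,s=1}^n(\sqrt[n]{z}+\epsilon^r\sqrt[n]{x}+\epsilon^s\sqrt[n]{y})$ with $\epsilon$ a primitive $n$-th root of unity; it is a homogeneous symmetric polynomial in $x,y,z$ of degree $n$ with integer coefficients. The discriminant of a one-variable polynomial $f(T)=\sum_{k=0}^d a_kT^k$ is taken in the form $\mathrm{disc}(f)=\frac{1}{a_d}\mathrm{res}(f,f')$, where $\mathrm{res}$ is the resultant. The discriminant of a homogeneous polynomial $F(u,v)$ is the resultant of its partial derivatives $\partial F/\partial u$, $\partial F/\partial v$; for two variables it is identified with the discriminant of the corresponding one-variable polynomial.
   Formalization: With disc = res(f,f')/a_d the sign must be (-1)^(n-1), not (-1)^n (n=2 gives disc = -p_2); in the homogenized form z is replaced by (-1)^n z (needed for odd n), and the resultant of its partials equals (2n-2)^(2n-4) times disc_T(P). *)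

theory Defs
  imports Complex_Main "Subresultants.Resultant_Prelim"
begin

text \<open>An element of this type is a polynomial in the outermost variable \<open>z\<close> whose coefficients
  are polynomials in \<open>y\<close> with coefficients that are polynomials in the innermost variable \<open>x\<close>.\<close>

type_synonym xyz_poly = "int poly poly poly"

definition X :: xyz_poly where "X = [:[:[:0, 1:]:]:]"
definition Y :: xyz_poly where "Y = [:[:0, 1:]:]"
definition Z :: xyz_poly where "Z = [:0, 1:]"

definition eval_xyz :: "xyz_poly \<Rightarrow> complex \<Rightarrow> complex \<Rightarrow> complex \<Rightarrow> complex" where
  "eval_xyz F x y z =
     poly (map_poly (\<lambda>G. poly (map_poly (\<lambda>H. poly (map_poly of_int H) x) G) y) F) z"

definition total_degree_xyz :: "xyz_poly \<Rightarrow> nat" where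
  "total_degree_xyz F =
     Max (insert 0 {i + j + k | i j k. coeff (coeff (coeff F k) j) i \<noteq> 0})"

definition primitive_unity_root :: "nat \<Rightarrow> complex \<Rightarrow> bool" where
  "primitive_unity_root n \<epsilon> \<longleftrightarrow> \<epsilon> ^ n = 1 \<and> (\<forall>k. 0 < k \<and> k < n \<longrightarrow> \<epsilon> ^ k \<noteq> 1)"

text \<open>Here \<open>a\<close>, \<open>b\<close>, \<open>c\<close> are arbitrary \<open>n\<close>-th roots of the arguments \<open>x\<close>, \<open>y\<close>, \<open>z\<close>. Existence and
  uniqueness of the polynomial are shown in \<open>ex1_is_p\<close> below.\<close>

definition is_p :: "nat \<Rightarrow> xyz_poly \<Rightarrow> bool" where
  "is_p n p \<longleftrightarrow> (\<forall>\<epsilon> a b c. primitive_unity_root n \<epsilon> \<longrightarrow>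
     eval_xyz p (a ^ n) (b ^ n) (c ^ n) = (\<Prod>r=1..n. \<Prod>s=1..n. c + \<epsilon> ^ r * a + \<epsilon> ^ s * b))"

definition p_poly :: "nat \<Rightarrow> xyz_poly" where
  "p_poly n = (THE p. is_p n p)"

text \<open>The division is exact. Note that for degree \<open>d\<close> this normalisation differs from
  the usual one (product of squared root differences) by the sign \<open>(-1)^(d*(d-1)/2)\<close>.\<close>

definition disc :: "'a :: idom_divide poly \<Rightarrow> 'a" where
  "disc f = resultant f (pderiv f) div lead_coeff f"

text \<open>A form in \<open>u, v\<close> is a polynomial in the outer variable \<open>u\<close> over polynomials in the inner
  variable \<open>v\<close>. The resultant of two binary forms is the Sylvester determinant of their
  dehomogenisations at \<open>v = 1\<close>, taken with respect to the degrees of the forms (not those of the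
  dehomogenisations).\<close>

definition dehomogenise :: "'a :: comm_ring_1 poly poly \<Rightarrow> 'a poly" where
  "dehomogenise F = map_poly (\<lambda>q. poly q 1) F"

definition form_resultant ::
  "nat \<Rightarrow> nat \<Rightarrow> 'a :: comm_ring_1 poly poly \<Rightarrow> 'a poly poly \<Rightarrow> 'a" where
  "form_resultant k l G H = resultant_sub k l (dehomogenise G) (dehomogenise H)"

definition form_disc :: "nat \<Rightarrow> 'a :: idom poly poly \<Rightarrow> 'a" where
  "form_disc d F = form_resultant (d - 1) (d - 1) (pderiv F) (map_poly pderiv F)"

definition P_poly :: "nat \<Rightarrow> 'a :: comm_ring_1 \<Rightarrow> 'a \<Rightarrow> 'a \<Rightarrow> 'a poly" where
  "P_poly n x y z = (let T = [:0, 1:] in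
     (smult ((-1) ^ n * x) (T ^ (n - 1)) + [:(-1) ^ n * y:]) * (1 + T) ^ (n - 1)
     - smult z (T ^ (n - 1)))"

text \<open>Dehomogenising \<open>P_form n x y ((-1)^n * z)\<close> at \<open>v = 1\<close> gives \<open>(-1)^n\<close> times \<open>P_poly n x y z\<close>;
  for odd \<open>n\<close> the sign of \<open>z\<close> matters.\<close>

definition P_form :: "nat \<Rightarrow> 'a :: comm_ring_1 \<Rightarrow> 'a \<Rightarrow> 'a \<Rightarrow> 'a poly poly" where
  "P_form n x y z = (let u = [:0, 1:]; v = [:[:0, 1:]:] in
     (u + v) ^ (n - 1) * ([:[:x:]:] * u ^ (n - 1) + [:[:y:]:] * v ^ (n - 1))
     - (u * v) ^ (n - 1) * [:[:z:]:])"

lemma comm_ring_hom_poly_eval: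
  assumes "comm_ring_hom h"
  shows "comm_ring_hom (\<lambda>p. poly (map_poly h p) x)"
proof -
  interpret h: comm_ring_hom h by fact
  interpret m: map_poly_comm_ring_hom h ..
  show ?thesis by unfold_locales (simp_all add: hom_distribs)
qed

lemma comm_ring_hom_eval_xyz: "comm_ring_hom (\<lambda>F. eval_xyz F x y z)"
proof -
  have "comm_ring_hom (of_int :: int \<Rightarrow> complex)" by unfold_locales auto
  then show ?thesis
    unfolding eval_xyz_def by (intro comm_ring_hom_poly_eval)
qed

lemma eval_xyz_vars [simp]:
  "eval_xyz X x y z = x" "eval_xyz Y x y z = y" "eval_xyz Z x y z = z"
  by (simp_all add: eval_xyz_def X_def Y_def Z_def map_poly_pCons)

lemma eval_xyz_0_imp_0:
  assumes "\<And>x y z. eval_xyz F x y z = 0"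
  shows "F = 0"
proof -
  have "coeff (coeff (coeff F k) j) i = 0" for i j k
  proof -
    define e1 where "e1 x = (\<lambda>H. poly (map_poly of_int H) (x :: complex))" for x
    define e2 where "e2 x y = (\<lambda>G. poly (map_poly (e1 x) G) y)" for x y
    have [simp]: "e1 x 0 = 0" "e2 x y 0 = 0" for x y by (simp_all add: e1_def e2_def)
    have "poly (map_poly (e2 x y) F) z = 0" for x y z
      using assms[of x y z] by (simp add: eval_xyz_def e1_def e2_def)
    then have "map_poly (e2 x y) F = 0" for x y
      using poly_all_0_iff_0 by blast
    then have "coeff (map_poly (e2 x y) F) k = 0" for x y by simp
    then have "e2 x y (coeff F k) = 0" for x y by (simp add: coeff_map_poly)
    then have "poly (map_poly (e1 x) (coeff F k)) y = 0" for x y by (simp add: e2_def)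
    then have "map_poly (e1 x) (coeff F k) = 0" for x
      using poly_all_0_iff_0 by blast
    then have "coeff (map_poly (e1 x) (coeff F k)) j = 0" for x by simp
    then have "e1 x (coeff (coeff F k) j) = 0" for x by (simp add: coeff_map_poly)
    then have "map_poly of_int (coeff (coeff F k) j) = (0 :: complex poly)"
      using poly_all_0_iff_0 unfolding e1_def by blast
    then have "coeff (map_poly of_int (coeff (coeff F k) j)) i = (0 :: complex)" by simp
    then show ?thesis by (simp add: coeff_map_poly)
  qed
  then show ?thesis by (intro poly_eqI) simp
qed

lemma primitive_unity_root_cis:
  assumes "n > 0"
  shows "primitive_unity_root n (cis (2 * pi / real n))"
proof -
  have "cis (2 * pi / real n) ^ k \<noteq> 1" if k: "0 < k" "k < n" for k
  proof
    assume "cis (2 * pi / real n) ^ k = 1"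
    then have "cis (2 * pi * real k / real n) = cis (2 * pi * real (0 :: nat) / real n)"
      by (simp add: DeMoivre mult_ac)
    then have "k = 0"
      using bij_betw_roots_unity[OF assms] k assms unfolding bij_betw_def inj_on_def by fastforce
    then show False using k by simp
  qed
  moreover have "cis (2 * pi / real n) ^ n = 1"
    using assms by (simp add: DeMoivre)
  ultimately show ?thesis by (simp add: primitive_unity_root_def)
qed

lemma primitive_unity_root_inj:
  assumes "primitive_unity_root n \<epsilon>"
  shows "inj_on (\<lambda>r. \<epsilon> ^ r) {1..n}"
proof -
  have "i = j" if "i \<in> {1..n}" "j \<in> {1..n}" "i \<le> j" "\<epsilon> ^ i = \<epsilon> ^ j" for i j
  proof (rule ccontr)
    assume "i \<noteq> j"
    with that have ij: "0 < j - i" "j - i < n" by auto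
    have "\<epsilon> \<noteq> 0" using assms ij by (auto simp: primitive_unity_root_def power_0_left)
    moreover have "\<epsilon> ^ j = \<epsilon> ^ i * \<epsilon> ^ (j - i)" using that by (metis le_add_diff_inverse power_add)
    ultimately have "\<epsilon> ^ (j - i) = 1" using that by simp
    then show False using assms ij by (auto simp: primitive_unity_root_def)
  qed
  then show ?thesis by (metis inj_onI nle_le)
qed

lemma prod_unity_roots:
  assumes n: "n > 0" and \<epsilon>: "primitive_unity_root n \<epsilon>"
  shows "(\<Prod>s=1..n. w + \<epsilon> ^ s * b) = w ^ n - (-b) ^ n"
proof -
  have inj: "inj_on (\<lambda>s. \<epsilon> ^ s) {1..n}" by (rule primitive_unity_root_inj[OF \<epsilon>])
  have sub: "(\<lambda>s. \<epsilon> ^ s) ` {1..n} \<subseteq> {z. z ^ n = 1}"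
    using \<epsilon> by (auto simp: primitive_unity_root_def mult.commute power_mult
        simp flip: power_mult) (metis mult.commute power_mult power_one)
  have img: "(\<lambda>s. \<epsilon> ^ s) ` {1..n} = {z. z ^ n = 1}"
    by (rule card_subset_eq[OF _ sub])
      (use n card_roots_unity_eq[OF n] card_image[OF inj] finite_roots_unity[of n] in auto)
  define q :: "complex poly" where "q = (\<Prod>s=1..n. [:- (\<epsilon> ^ s), 1:])"
  define d where "d = monom 1 n - 1 - q"
  have degq: "degree q = n"
    unfolding q_def by (simp add: degree_prod_eq_sum_degree)
  have lcq: "lead_coeff q = 1"
    unfolding q_def lead_coeff_prod by simp
  have "d = 0"
  proof (rule ccontr)
    assume d0: "d \<noteq> 0"
    have deg: "degree d < n"
    proof -
      have "degree d \<le> n" unfolding d_def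
        by (intro degree_diff_le) (use degq in \<open>auto simp: degree_monom_eq\<close>)
      moreover have "coeff d n = 0" using lcq degq n by (simp add: d_def)
      ultimately show ?thesis using d0 by (metis leading_coeff_0_iff le_neq_implies_less)
    qed
    have "(\<lambda>s. \<epsilon> ^ s) ` {1..n} \<subseteq> {z. poly d z = 0}"
    proof safe
      fix s assume s: "s \<in> {1..n}"
      then have "poly q (\<epsilon> ^ s) = 0" by (auto simp: q_def poly_prod)
      moreover have "(\<epsilon> ^ s) ^ n = 1" using s sub by blast
      ultimately show "poly d (\<epsilon> ^ s) = 0" by (simp add: d_def poly_monom)
    qed
    then have "card ((\<lambda>s. \<epsilon> ^ s) ` {1..n}) \<le> card {z. poly d z = 0}"
      by (intro card_mono poly_roots_finite d0)
    also have "\<dots> \<le> degree d" by (rule card_poly_roots_bound[OF d0])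
    finally show False using deg card_image[OF inj] by simp
  qed
  then have q: "(\<Prod>s=1..n. t - \<epsilon> ^ s) = t ^ n - 1" for t
  proof -
    have "poly q t = poly (monom 1 n - 1) t" using \<open>d = 0\<close> by (simp add: d_def)
    then show ?thesis by (simp add: q_def poly_prod poly_monom)
  qed
  show ?thesis
  proof (cases "b = 0")
    case True
    then show ?thesis using n by simp
  next
    case False
    define t where "t = w / (-b)"
    have wt: "w = (-b) * t" using False by (simp add: t_def)
    have "(\<Prod>s=1..n. w + \<epsilon> ^ s * b) = (\<Prod>s=1..n. (-b) * (t - \<epsilon> ^ s))"
      unfolding wt by (intro prod.cong) (auto simp: algebra_simps)
    also have "\<dots> = (\<Prod>s=1..n. -b) * (\<Prod>s=1..n. t - \<epsilon> ^ s)"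
      by (rule prod.distrib)
    also have "\<dots> = (-b) ^ n * (t ^ n - 1)"
      unfolding q by simp
    also have "\<dots> = w ^ n - (-b) ^ n"
      unfolding wt by (simp only: power_mult_distrib right_diff_distrib mult_1_right)
    finally show ?thesis .
  qed
qed

definition p_mat :: "nat \<Rightarrow> 'a :: comm_ring_1 \<Rightarrow> 'a \<Rightarrow> 'a \<Rightarrow> 'a mat" where
  "p_mat n x y z = mat n n (\<lambda>(i, j).
     if i = j then z + x - (-1) ^ n * y
     else if j < i then of_nat (n choose (i - j)) * z else of_nat (n choose (j - i)) * x)"

lemma p_mat_eigen:
  fixes u x y z :: complex
  assumes j: "j < n" and u: "z * u ^ n = x"
  shows "(\<Sum>i<n. u ^ i * p_mat n x y z $$ (i, j)) = (z * (1 + u) ^ n - (-1) ^ n * y) * u ^ j"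
proof -
  define g where "g i = u ^ i * p_mat n x y z $$ (i, j)" for i
  define b where "b k = of_nat (n choose k) * u ^ k" for k
  have n: "n > 0" using j by simp
  have lt: "(\<Sum>i<j. g i) = z * u ^ j * (\<Sum>k=n-j..<n. b k)"
  proof -
    have "z * u ^ j * (\<Sum>k=n-j..<n. b k) = (\<Sum>k=0+(n-j)..<j+(n-j). z * u ^ j * b k)"
      using j by (simp add: sum_distrib_left)
    also have "\<dots> = (\<Sum>i=0..<j. z * u ^ j * b (i + (n - j)))"
      by (rule sum.shift_bounds_nat_ivl)
    also have "\<dots> = (\<Sum>i=0..<j. g i)"
    proof (rule sum.cong)
      fix i assume i: "i \<in> {0..<j}"
      have "n choose (i + (n - j)) = n choose (j - i)"
        using i j by (subst binomial_symmetric) auto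
      moreover have "u ^ j * u ^ (i + (n - j)) = u ^ n * u ^ i"
        using i j by (simp add: add.commute flip: power_add)
      ultimately show "z * u ^ j * b (i + (n - j)) = g i"
        using i j by (simp add: b_def g_def p_mat_def flip: u)
    qed simp
    finally show ?thesis by (simp add: atLeast0LessThan)
  qed
  have gt: "(\<Sum>i=Suc j..<n. g i) = z * u ^ j * (\<Sum>k=1..<n-j. b k)"
  proof -
    have "(\<Sum>i=Suc j..<n. g i) = (\<Sum>i=1+j..<(n-j)+j. g i)" using j by simp
    also have "\<dots> = (\<Sum>k=1..<n-j. g (k + j))"
      by (rule sum.shift_bounds_nat_ivl)
    also have "\<dots> = (\<Sum>k=1..<n-j. z * u ^ j * b k)"
      by (intro sum.cong) (use j in \<open>auto simp: g_def b_def p_mat_def power_add\<close>)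
    finally show ?thesis by (simp add: sum_distrib_left)
  qed
  have gj: "g j = (z + x - (-1) ^ n * y) * u ^ j"
    using j by (simp add: g_def p_mat_def)
  have "(1 + u) ^ n = (\<Sum>k\<le>n. b k)"
    by (subst add.commute, subst binomial_ring) (simp add: b_def)
  also have "{..n} = insert 0 (insert n {1..<n})" using n by auto
  also have "(\<Sum>k\<in>\<dots>. b k) = 1 + u ^ n + (\<Sum>k=1..<n. b k)"
    using n by (simp add: b_def)
  also have "(\<Sum>k=1..<n. b k) = (\<Sum>k=1..<n-j. b k) + (\<Sum>k=n-j..<n. b k)"
    using j by (subst sum.atLeastLessThan_concat) auto
  finally have bin: "(1 + u) ^ n = 1 + u ^ n + ((\<Sum>k=1..<n-j. b k) + (\<Sum>k=n-j..<n. b k))" .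
  have "{..<n} = {..<j} \<union> insert j {Suc j..<n}" using j by auto
  then have "(\<Sum>i<n. g i) = (\<Sum>i\<in>{..<j} \<union> insert j {Suc j..<n}. g i)" by simp
  also have "\<dots> = (\<Sum>i<j. g i) + (g j + (\<Sum>i=Suc j..<n. g i))"
    by (subst sum.union_disjoint) auto
  also have "\<dots> = (z * (1 + u) ^ n - (-1) ^ n * y) * u ^ j"
    unfolding lt gt gj bin by (simp add: algebra_simps flip: u)
  finally show ?thesis by (simp add: g_def)
qed

lemma det_vandermonde_nz:
  fixes u :: "nat \<Rightarrow> complex"
  assumes inj: "inj_on u {..<n}"
  shows "det (mat n n (\<lambda>(r, i). u r ^ i)) \<noteq> 0"
proof
  let ?V = "mat n n (\<lambda>(r, i). u r ^ i)"
  assume "det ?V = 0"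
  then obtain v where v: "v \<in> carrier_vec n" "v \<noteq> 0\<^sub>v n" "?V *\<^sub>v v = 0\<^sub>v n"
    using det_0_iff_vec_prod_zero[of ?V n] by auto
  define q where "q = (\<Sum>i<n. monom (v $ i) i)"
  have coeffq: "coeff q i = (if i < n then v $ i else 0)" for i
    by (simp add: q_def coeff_sum)
  have "q \<noteq> 0"
  proof
    assume "q = 0"
    then have "v $ i = 0" if "i < n" for i using coeffq[of i] that by simp
    then have "v = 0\<^sub>v n" using v(1) by (intro eq_vecI) auto
    then show False using v(2) by simp
  qed
  then have "n > 0" using coeffq by (metis less_nat_zero_code neq0_conv poly_eqI coeff_0)
  have deg: "degree q < n"
    using \<open>q \<noteq> 0\<close> coeffq by (metis leading_coeff_0_iff)
  have root: "poly q (u r) = 0" if r: "r < n" for r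
  proof -
    have "0 = (?V *\<^sub>v v) $ r" using v(3) r by simp
    also have "\<dots> = (\<Sum>i<n. u r ^ i * v $ i)"
      using r v(1) by (simp add: scalar_prod_def atLeast0LessThan)
    also have "\<dots> = poly q (u r)"
      by (simp add: q_def poly_sum poly_monom mult.commute)
    finally show ?thesis by simp
  qed
  have "card (u ` {..<n}) \<le> card {t. poly q t = 0}"
    using root \<open>q \<noteq> 0\<close> by (intro card_mono poly_roots_finite) auto
  also have "\<dots> \<le> degree q" by (rule card_poly_roots_bound[OF \<open>q \<noteq> 0\<close>])
  finally show False using deg card_image[OF inj] by simp
qed

lemma det_p_mat:
  assumes n: "n > 0" and \<epsilon>: "primitive_unity_root n \<epsilon>"
  shows "det (p_mat n (a ^ n) (b ^ n) (c ^ n)) = (\<Prod>r=1..n. \<Prod>s=1..n. c + \<epsilon> ^ r * a + \<epsilon> ^ s * b)"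
proof -
  let ?M = "p_mat n (a ^ n) (b ^ n) (c ^ n)"
  have M: "?M \<in> carrier_mat n n" by (simp add: p_mat_def)
  have bn: "(-1) ^ n * b ^ n = (-b) ^ n" by (simp flip: power_mult_distrib)
  have \<epsilon>n: "(\<epsilon> ^ r) ^ n = 1" for r
  proof -
    have "(\<epsilon> ^ r) ^ n = (\<epsilon> ^ n) ^ r" by (simp only: power_mult [symmetric] mult.commute)
    then show ?thesis using \<epsilon> by (simp add: primitive_unity_root_def)
  qed
  have rhs: "(\<Prod>r=1..n. \<Prod>s=1..n. c + \<epsilon> ^ r * a + \<epsilon> ^ s * b)
      = (\<Prod>r=1..n. (c + \<epsilon> ^ r * a) ^ n - (-b) ^ n)"
    by (intro prod.cong refl prod_unity_roots[OF n \<epsilon>])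
  consider "a = 0" | "c = 0" | "a \<noteq> 0" "c \<noteq> 0" by blast
  then show ?thesis
  proof cases
    case 1
    then have "det ?M = prod_list (diag_mat ?M)"
      using n by (intro det_lower_triangular[OF _ M]) (auto simp: p_mat_def)
    also have "\<dots> = (\<Prod>i<n. c ^ n - (-b) ^ n)"
      using 1 n by (simp add: prod_list_diag_prod p_mat_def atLeast0LessThan bn power_0_left)
    finally show ?thesis unfolding rhs using 1 by simp
  next
    case 2
    then have "det ?M = prod_list (diag_mat ?M)"
      using n by (intro det_upper_triangular[OF _ M]) (auto simp: p_mat_def upper_triangular_def)
    also have "\<dots> = (\<Prod>i<n. a ^ n - (-b) ^ n)"
      using 2 n by (simp add: prod_list_diag_prod p_mat_def atLeast0LessThan bn power_0_left)
    finally show ?thesis unfolding rhs using 2 by (simp add: power_mult_distrib \<epsilon>n)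
  next
    case 3
    define u where "u r = \<epsilon> ^ Suc r * a / c" for r
    define l where "l r = (c + \<epsilon> ^ Suc r * a) ^ n - (-b) ^ n" for r
    define V where "V = mat n n (\<lambda>(r, i). u r ^ i)"
    define D where "D = mat n n (\<lambda>(r, i). if r = i then l r else 0)"
    have VD: "V \<in> carrier_mat n n" "D \<in> carrier_mat n n" by (simp_all add: V_def D_def)
    have "V * ?M = D * V"
    proof (rule eq_matI)
      fix r j assume "r < dim_row (D * V)" "j < dim_col (D * V)"
      then have rj: "r < n" "j < n" by (simp_all add: V_def D_def)
      have un: "c ^ n * u r ^ n = a ^ n"
        using 3 by (simp add: u_def power_divide power_mult_distrib \<epsilon>n del: power_Suc)
      have "c * (1 + u r) = c + \<epsilon> ^ Suc r * a"
        using 3 by (simp add: u_def field_simps)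
      then have lr: "l r = c ^ n * (1 + u r) ^ n - (-1) ^ n * b ^ n"
        unfolding l_def bn by (simp only: power_mult_distrib [symmetric])
      have "(V * ?M) $$ (r, j) = (\<Sum>i<n. u r ^ i * ?M $$ (i, j))"
        using rj M VD by (simp add: scalar_prod_def V_def atLeast0LessThan)
      also have "\<dots> = l r * u r ^ j"
        unfolding lr by (rule p_mat_eigen[OF rj(2) un])
      also have "\<dots> = (\<Sum>i<n. (if r = i then l r else 0) * u i ^ j)"
      proof -
        have "(\<Sum>i<n. (if r = i then l r else 0) * u i ^ j)
            = (\<Sum>i<n. if r = i then l r * u i ^ j else 0)"
          by (intro sum.cong) auto
        then show ?thesis using rj by simp
      qed
      also have "\<dots> = (D * V) $$ (r, j)"
        using rj VD by (simp add: scalar_prod_def V_def D_def atLeast0LessThan)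
      finally show "(V * ?M) $$ (r, j) = (D * V) $$ (r, j)" .
    qed (use M VD in auto)
    then have "det (V * ?M) = det (D * V)" by (rule arg_cong)
    then have "det V * det ?M = det D * det V"
      unfolding det_mult[OF VD(1) M] det_mult[OF VD(2) VD(1)] .
    moreover have "inj_on u {..<n}"
    proof (rule inj_onI)
      fix r s assume rs: "r \<in> {..<n}" "s \<in> {..<n}" "u r = u s"
      have "\<epsilon> ^ Suc r = \<epsilon> ^ Suc s"
        using rs(3) 3 by (simp add: u_def del: power_Suc)
      then have "Suc r = Suc s"
        by (rule inj_onD[OF primitive_unity_root_inj[OF \<epsilon>]]) (use rs in auto)
      then show "r = s" by simp
    qed
    then have "det V \<noteq> 0" unfolding V_def by (rule det_vandermonde_nz)
    ultimately have "det ?M = det D" by simp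
    also have "\<dots> = prod_list (diag_mat D)"
      by (rule det_upper_triangular[OF _ VD(2)]) (auto simp: D_def upper_triangular_def)
    also have "\<dots> = (\<Prod>r<n. l r)"
      by (simp add: prod_list_diag_prod D_def atLeast0LessThan)
    also have "\<dots> = (\<Prod>r=1..n. (c + \<epsilon> ^ r * a) ^ n - (-b) ^ n)"
      unfolding l_def by (simp only: One_nat_def prod.atLeast1_atMost_eq)
    finally show ?thesis unfolding rhs .
  qed
qed

lemma ex1_is_p:
  assumes n: "n > 0"
  shows "\<exists>!p. is_p n p"
proof (rule ex_ex1I)
  have "eval_xyz (det (p_mat n X Y Z)) x y z = det (p_mat n x y z)" for x y z
  proof -
    interpret comm_ring_hom "\<lambda>F. eval_xyz F x y z" by (rule comm_ring_hom_eval_xyz)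
    have "map_mat (\<lambda>F. eval_xyz F x y z) (p_mat n X Y Z) = p_mat n x y z"
      by (intro eq_matI) (auto simp: p_mat_def hom_distribs)
    then show ?thesis by (simp flip: hom_det)
  qed
  then have "is_p n (det (p_mat n X Y Z))"
    by (simp add: is_p_def det_p_mat[OF n])
  then show "\<exists>p. is_p n p" ..
next
  fix p q assume pq: "is_p n p" "is_p n q"
  have "eval_xyz (p - q) x y z = 0" for x y z
  proof -
    interpret comm_ring_hom "\<lambda>F. eval_xyz F x y z" by (rule comm_ring_hom_eval_xyz)
    have root: "\<exists>w. t = w ^ n" for t :: complex
    proof (cases "t = 0")
      case True
      then show ?thesis using n by (intro exI[of _ 0]) simp
    next
      case False
      then have "{w. w ^ n = t} \<noteq> {}" using card_nth_roots[OF False n] n by force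
      then show ?thesis by blast
    qed
    obtain a b c where "x = a ^ n" "y = b ^ n" "z = c ^ n"
      using root by metis
    then have "eval_xyz p x y z = eval_xyz q x y z"
      using pq primitive_unity_root_cis[OF n] by (simp add: is_p_def)
    moreover have "eval_xyz (p - q) x y z = eval_xyz p x y z - eval_xyz q x y z"
      by (rule hom_minus)
    ultimately show ?thesis by simp
  qed
  then show "p = q" using eval_xyz_0_imp_0 by fastforce
qed

end

theory Submission
  imports Defs "Subresultants.Subresultant" "HOL-Computational_Algebra.Fundamental_Theorem_Algebra"
begin


text \<open>Let g = P / T^(n-1). Then T^n g' = h with h = (-1)^n (n-1) (1+T)^(n-2) (x T^n - y), so
  at every root of P the values of T P' and h agree. Hence the resultant of P and h is P(0) = (-1)^n
  y times the resultant of P and P'. Read from the other side, it is, up to a power of the leading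
  coefficient of h, the product of the values of P at the roots of h, and these roots are explicit:
  -1 with multiplicity n-2, where P takes the value (-1)^n z, and the n solutions t of x t^n = y,
  where P(t) = t^(n-1) ((-1)^n x (1+t)^n - z). For x = a^n, y = b^n, z = c^n these solutions are t =
  \<epsilon>^k b/a, and x (1+t)^n = (a + \<epsilon>^k b)^n, so the last factors multiply to p_n up
  to sign. The lemmas behind this are \<open>resultant_eq_prod_roots\<close>,
  \<open>P_poly_pderiv\<close>, \<open>prod_unity_roots_swap\<close> and
  \<open>resultant_P_poly\<close>.

  The identity of polynomials follows because an integer polynomial in x, y, z that vanishes at all
  complex points is zero (\<open>resultant_P_poly_xyz\<close>). The degree follows because p_n is
  the determinant of an n by n matrix of linear forms.

  For the form of degree d = 2n-2, Euler's identity turns the two partial derivatives at v = 1 into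
  f' and d f - T f', where f = (-1)^n P. At the roots of f' the second one is d f, so their
  resultant is that of f and f' up to explicit constants (\<open>resultant_sub_pderiv\<close>); this
  is the source of the factor d^(d-2).\<close>

section \<open>The resultant as a product of values at roots\<close>

text \<open>One step of the Euclidean algorithm on resultants, taken from the Brown-Traub identities
  for the subresultant of index 0. A constant remainder is a separate case because
  \<open>BT_lemma_1_12\<close> covers only indices below the degree of the remainder.\<close>

lemma resultant_mod:
  fixes f g :: "'a :: {field} poly"
  assumes le: "degree g \<le> degree f" and g: "0 < degree g"
  shows "resultant f g = (-1) ^ (degree f * degree g) *
    lead_coeff g ^ (degree f - degree (f mod g)) * resultant g (f mod g)"
proof -
  define h where "h = f mod g"
  have eq: "f + (- (f div g)) * g = h"
    by (simp add: h_def minus_div_mult_eq_mod)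
  have lt: "degree g > degree h"
    using g by (cases "h = 0") (auto simp: h_def intro!: degree_mod_less')
  show ?thesis
  proof (cases "degree h = 0")
    case False
    have "subresultant 0 f g = smult ((-1)^(degree f * degree g) * lead_coeff g ^ (degree f - degree h))
        (subresultant 0 g h)"
      using BT_lemma_1_12[OF eq le, of 0] lt False by simp
    then show ?thesis by (simp add: subresultant_resultant h_def)
  next
    case True
    then obtain c where c: "h = [:c:]" by (rule degree_eq_zeroE)
    have "subresultant (degree h) f g = smult ((-1)^(degree f * degree g) * lead_coeff g ^ degree f
        * lead_coeff h ^ (degree g - 1)) h"
      using BT_lemma_1_13[OF eq le] lt True by simp
    then have "resultant f g = (-1)^(degree f * degree g) * lead_coeff g ^ degree f * (c ^ (degree g - 1) * c)"
      using True by (simp add: subresultant_resultant c)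
    also have "c ^ (degree g - 1) * c = resultant g h"
      using g by (simp add: c flip: power_Suc2)
    finally show ?thesis using True by (simp add: h_def)
  qed
qed

lemma degree_prod_linear: "degree (\<Prod>a\<leftarrow>as. [:- a, 1 :: 'a :: idom:]) = length as"
proof (induction as)
  case (Cons a as)
  have "(\<Prod>a\<leftarrow>as. [:- a, 1:]) \<noteq> 0" by (auto simp: prod_list_zero_iff)
  then show ?case using Cons by (simp add: degree_mult_eq del: mult_pCons_left)
qed simp

lemma lead_coeff_prod_linear: "lead_coeff (\<Prod>a\<leftarrow>as. [:- a, 1 :: 'a :: idom:]) = 1"
  by (induction as) (auto simp: lead_coeff_mult simp del: mult_pCons_left)

lemma prod_linear_swap:
  fixes as bs :: "'a :: idom list"
  shows "(\<Prod>a\<leftarrow>as. \<Prod>b\<leftarrow>bs. a - b) = (-1) ^ (length as * length bs) * (\<Prod>b\<leftarrow>bs. \<Prod>a\<leftarrow>as. b - a)"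
proof (induction as)
  case (Cons a as)
  have "(\<Prod>b\<leftarrow>bs. a - b) = (-1) ^ length bs * (\<Prod>b\<leftarrow>bs. b - a)"
    by (induction bs) (auto simp: algebra_simps)
  then show ?case using Cons by (simp add: prod_list_multf power_add mult_ac)
qed (simp add: map_replicate_const)

lemma poly_prod_linear: "poly (\<Prod>b\<leftarrow>bs. [:- b, 1 :: 'a :: comm_ring_1:]) a = (\<Prod>b\<leftarrow>bs. a - b)"
  by (induction bs) (auto simp: algebra_simps)

lemmas poly_prod_linear' = poly_prod_linear[unfolded pCons_one]

lemma prod_list_const_mult:
  "(\<Prod>a\<leftarrow>as. c * (g a :: 'a :: comm_monoid_mult)) = c ^ length as * (\<Prod>a\<leftarrow>as. g a)"
  by (induction as) (auto simp: mult_ac)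

lemma prod_poly_factored:
  assumes "p = smult c (\<Prod>b\<leftarrow>bs. [:- b, 1 :: 'a :: comm_ring_1:])"
  shows "(\<Prod>a\<leftarrow>as. poly p a) = c ^ length as * (\<Prod>a\<leftarrow>as. \<Prod>b\<leftarrow>bs. a - b)"
proof -
  have "poly p a = c * (\<Prod>b\<leftarrow>bs. a - b)" for a
    unfolding assms by (simp add: poly_prod_linear')
  then show ?thesis by (induction as) (auto simp: mult_ac)
qed

lemma linear_factorization:
  obtains as where "(f :: complex poly) = smult (lead_coeff f) (\<Prod>a\<leftarrow>as. [:- a, 1:])"
proof (cases "f = 0")
  case False
  obtain A where "size A = degree f" "f = smult (lead_coeff f) (\<Prod>a\<in>#A. [:- a, 1:])"
    using alg_closed_imp_factorization[OF False] by blast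
  moreover obtain as where "mset as = A" using ex_mset by blast
  ultimately show ?thesis by (metis mset_map prod_mset_prod_list that)
qed (simp add: that)

text \<open>The product formula has the same symmetry as the resultant: exchanging f and g costs the
  sign (-1)^(degree f * degree g). After the exchange it is a product over the roots of g, where f
  and \<open>f mod g\<close> take equal values, so it obeys the same Euclidean recursion as
  \<open>resultant_mod\<close>. The induction is on the degree of the second argument, which drops
  both on a swap with degree f < degree g and on passing to the remainder.\<close>

theorem resultant_eq_prod_roots:
  fixes f g :: "complex poly"
  assumes "f = smult c (\<Prod>a\<leftarrow>as. [:- a, 1:])" "c \<noteq> 0"
  shows "resultant f g = c ^ degree g * (\<Prod>a\<leftarrow>as. poly g a)"
  using assms
proof (induction "degree g" arbitrary: f g c as rule: less_induct)
  case less
  have deg_f: "degree f = length as" and lc_f: "lead_coeff f = c"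
    using less.prems degree_prod_linear[of as] lead_coeff_prod_linear[of as] by simp_all
  show ?case
  proof (cases "degree g = 0")
    case True
    then obtain d where "g = [:d:]" by (rule degree_eq_zeroE)
    moreover have "(\<Prod>a\<leftarrow>xs. poly [:d:] a) = d ^ length xs" for xs
      by (induction xs) auto
    ultimately show ?thesis
      by (simp only: deg_f resultant_const degree_pCons_0 power_0 mult_1)
  next
    case False
    then have deg_g: "degree g > 0" by simp
    then have "g \<noteq> 0" by auto
    obtain bs where bs: "g = smult (lead_coeff g) (\<Prod>b\<leftarrow>bs. [:- b, 1:])"
      by (rule linear_factorization)
    have len: "degree g = length bs" 
      using \<open>g \<noteq> 0\<close> degree_prod_linear[of bs] by (subst bs) simp
    \<comment> \<open>Both sides are the two leading coefficients, to the appropriate powers, times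
      the double product of root differences.\<close>
    have swap: "c ^ degree g * (\<Prod>a\<leftarrow>as. poly g a) =
      (-1) ^ (degree f * degree g) * (lead_coeff g ^ degree f * (\<Prod>b\<leftarrow>bs. poly f b))"
    proof -
      note prod_poly_factored[OF bs, of as]
      moreover note prod_poly_factored[OF less.prems(1), of bs]
      ultimately show ?thesis
        unfolding prod_linear_swap[where as = as and bs = bs] by (simp add: deg_f len)
    qed
    show ?thesis
    proof (cases "degree f < degree g")
      case True
      have "resultant g f = lead_coeff g ^ degree f * (\<Prod>b\<leftarrow>bs. poly f b)"
        using less.hyps[OF True bs] \<open>g \<noteq> 0\<close> by simp
      then show ?thesis unfolding swap resultant_swap[of f g] by simp
    next
      case False
      define h where "h = f mod g"
      have lt: "degree h < degree g" 
        using deg_g by (cases "h = 0") (auto simp: h_def intro!: degree_mod_less')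
      have root: "poly h b = poly f b" if "b \<in> set bs" for b
      proof -
        have "poly g b = 0" using that by (subst bs) (auto simp: poly_prod_linear' prod_list_zero_iff)
        moreover have "poly f b = poly (f div g * g + h) b" by (simp add: h_def)
        ultimately show ?thesis by simp
      qed
      have "resultant f g = (-1) ^ (degree f * degree g) *
          (lead_coeff g ^ (degree f - degree h) * (lead_coeff g ^ degree h * (\<Prod>b\<leftarrow>bs. poly h b)))"
        using resultant_mod[of g f] less.hyps[OF lt bs] \<open>g \<noteq> 0\<close> False deg_g by (simp add: h_def)
      also have "map (poly h) bs = map (poly f) bs" using root by simp
      also have "lead_coeff g ^ (degree f - degree h) * (lead_coeff g ^ degree h * (\<Prod>b\<leftarrow>bs. poly f b))
          = lead_coeff g ^ degree f * (\<Prod>b\<leftarrow>bs. poly f b)"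
        using lt False by (simp flip: power_add mult.assoc)
      finally show ?thesis unfolding swap .
    qed
  qed
qed


section \<open>Sylvester determinants with prescribed degrees\<close>

text \<open>If the prescribed degree of g is one too large, the first column of the Sylvester matrix
  has only its top entry left, and Laplace expansion along it strips one row and one column.\<close>

lemma resultant_sub_Suc:
  fixes f g :: "'a :: comm_ring_1 poly"
  assumes "coeff g (Suc n) = 0"
  shows "resultant_sub m (Suc n) f g = coeff f m * resultant_sub m n f g"
proof -
  let ?S = "sylvester_mat_sub m (Suc n) f g"
  have S: "?S \<in> carrier_mat (Suc (m + n)) (Suc (m + n))" by auto
  have col: "?S $$ (i, 0) = (if i = 0 then coeff f m else 0)" if "i < Suc (m + n)" for i
    using that assms by (auto simp: sylvester_mat_sub_index)
  have minor: "mat_delete ?S 0 0 = sylvester_mat_sub m n f g"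
  proof (intro eq_matI)
    fix i j assume "i < dim_row (sylvester_mat_sub m n f g)" "j < dim_col (sylvester_mat_sub m n f g)"
    then have ij: "i < m + n" "j < m + n" by auto
    have "mat_delete ?S 0 0 $$ (i, j) = ?S $$ (Suc i, Suc j)"
      using ij by (simp add: mat_delete_def)
    also have "\<dots> = sylvester_mat_sub m n f g $$ (i, j)"
    \<comment> \<open>The bands of the two matrices differ only here: the larger one reaches the
      coefficient of g at \<open>Suc n\<close>, which is zero, where the smaller one is already
      outside its band.\<close>
    proof (cases "\<not> i < n \<and> i - n = Suc j")
      case True
      then have "i - j = Suc n" by auto
      then show ?thesis using True ij assms by (auto simp: sylvester_mat_sub_index)
    next
      case False
      then show ?thesis using ij by (auto simp: sylvester_mat_sub_index)
    qed
    finally show "mat_delete ?S 0 0 $$ (i, j) = sylvester_mat_sub m n f g $$ (i, j)" .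
  qed (auto simp: mat_delete_def)
  have "det ?S = (\<Sum>i<Suc (m + n). ?S $$ (i, 0) * cofactor ?S i 0)"
    by (rule laplace_expansion_column[OF S]) simp
  also have "\<dots> = (\<Sum>i<Suc (m + n). if i = 0 then coeff f m * cofactor ?S 0 0 else 0)"
    by (intro sum.cong) (auto simp: col)
  also have "\<dots> = coeff f m * resultant_sub m n f g"
    by (subst sum.delta) (auto simp: cofactor_def minor resultant_sub_def)
  finally show ?thesis by (simp add: resultant_sub_def)
qed

lemma resultant_sub_degree_le:
  fixes f g :: "'a :: comm_ring_1 poly"
  assumes "degree g \<le> n"
  shows "resultant_sub (degree f) n f g = lead_coeff f ^ (n - degree g) * resultant f g"
  using assms
proof (induction n rule: dec_induct)
  case base
  show ?case by (simp add: resultant_sub)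
next
  case (step n)
  then show ?case by (simp add: resultant_sub_Suc coeff_eq_0 Suc_diff_le)
qed

text \<open>The second argument is the v-derivative of the form at v = 1, rewritten by Euler's
  identity. Its terms of degree d cancel and its true degree may be smaller still, hence the
  prescribed degree d-1. With c = d * lead_coeff f, the leading coefficient of f', the determinant
  is c^(d-1) d^(d-1) times the product of f over the roots of f', while the resultant of f and f' is
  c^d times that product.\<close>

lemma resultant_sub_pderiv:
  fixes f :: "complex poly"
  assumes d: "degree f = d" "d \<ge> 2"
  shows "lead_coeff f * resultant_sub (d - 1) (d - 1) (pderiv f)
      (smult (of_nat d) f - [:0, 1:] * pderiv f) = of_nat d ^ (d - 2) * resultant f (pderiv f)"
proof -
  let ?g = "smult (of_nat d) f - [:0, 1:] * pderiv f"
  define c where "c = of_nat d * lead_coeff f"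
  have deg: "degree (pderiv f) = d - 1" using d by (simp add: degree_pderiv)
  have "f \<noteq> 0" using d by auto
  then have c0: "c \<noteq> 0" using d by (auto simp: c_def)
  have lc: "lead_coeff (pderiv f) = c"
    using d by (simp add: deg c_def coeff_pderiv)
  obtain as where as: "pderiv f = smult c (\<Prod>a\<leftarrow>as. [:- a, 1:])"
    using linear_factorization[of "pderiv f"] lc by auto
  have len: "length as = d - 1"
    using deg c0 degree_prod_linear[of as] unfolding as by simp
  have root: "poly (pderiv f) a = 0" if "a \<in> set as" for a
    using that by (auto simp: as poly_prod_linear' prod_list_zero_iff)
  have "degree ?g \<le> d - 1"
  proof (rule degree_le, safe)
    fix i assume "i > d - 1"
    then have "i = d \<or> i > d" by auto
    then show "coeff ?g i = 0"
      using d by (auto simp: coeff_eq_0 deg coeff_pderiv coeff_pCons split: nat.split)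
  qed
  then have "resultant_sub (d - 1) (d - 1) (pderiv f) ?g
      = c ^ (d - 1 - degree ?g) * (c ^ degree ?g * (\<Prod>a\<leftarrow>as. poly ?g a))"
    using resultant_sub_degree_le[of ?g "d - 1" "pderiv f"] resultant_eq_prod_roots[OF as c0, of ?g] lc
    unfolding deg by simp
  also have "\<dots> = c ^ (d - 1) * (\<Prod>a\<leftarrow>as. poly ?g a)"
    using \<open>degree ?g \<le> d - 1\<close>
    by (simp only: mult.assoc [symmetric] power_add [symmetric] le_add_diff_inverse2)
  also have "map (poly ?g) as = map (\<lambda>a. of_nat d * poly f a) as"
    using root by simp
  also have "(\<Prod>a\<leftarrow>as. of_nat d * poly f a) = of_nat d ^ (d - 1) * (\<Prod>a\<leftarrow>as. poly f a)"
    by (simp add: prod_list_const_mult len)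
  finally have sub: "resultant_sub (d - 1) (d - 1) (pderiv f) ?g
      = c ^ (d - 1) * (of_nat d ^ (d - 1) * (\<Prod>a\<leftarrow>as. poly f a))" .
  have "even (d * (d - 1))" by (cases d) auto
  then have "resultant f (pderiv f) = resultant (pderiv f) f"
    using resultant_swap[of f "pderiv f"] by (simp add: deg d(1))
  also have "\<dots> = c ^ d * (\<Prod>a\<leftarrow>as. poly f a)"
    using resultant_eq_prod_roots[OF as c0, of f] d by simp
  finally have res: "resultant f (pderiv f) = c ^ d * (\<Prod>a\<leftarrow>as. poly f a)" .
  obtain k where k: "d = k + 2" using d(2) by (metis le_add_diff_inverse2)
  show ?thesis
    unfolding sub res c_def by (simp add: k algebra_simps)
qed


section \<open>The resultant at complex points\<close>

lemma P_poly_altdef: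
  "P_poly n x y z = (monom ((-1) ^ n * x) (n - 1) + [:(-1) ^ n * y:]) * [:1, 1:] ^ (n - 1)
    - monom z (n - 1)"
proof -
  have "1 + [:0, 1:] = [:1, 1 :: 'a:]"
    by (intro poly_eqI) (auto simp: coeff_pCons split: nat.split)
  then show ?thesis unfolding P_poly_def Let_def monom_altdef by (simp only:)
qed

lemma
  fixes x y z :: "'a :: idom"
  assumes n: "n \<ge> 2" and x: "x \<noteq> 0"
  shows degree_P_poly: "degree (P_poly n x y z) = 2 * n - 2"
    and lead_coeff_P_poly: "lead_coeff (P_poly n x y z) = (-1) ^ n * x"
proof -
  define A where "A = monom ((-1) ^ n * x) (n - 1) + [:(-1) ^ n * y:]"
  have "degree (monom ((-1) ^ n * x) (n - 1)) = n - 1"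
    using x by (simp add: degree_monom_eq)
  then have degA: "degree A = n - 1"
    unfolding A_def using n by (subst degree_add_eq_left) auto
  have cA: "coeff A (n - 1) = (-1) ^ n * x"
    using n unfolding A_def by (simp add: coeff_pCons split: nat.split)
  then have "A \<noteq> 0" using x by auto
  then have degAB: "degree (A * [:1, 1:] ^ (n - 1)) = 2 * n - 2"
    by (simp add: degree_mult_eq degree_power_eq degA)
  have "lead_coeff (A * [:1, 1:] ^ (n - 1)) = (-1) ^ n * x"
    unfolding lead_coeff_mult lead_coeff_power degA cA by simp
  then have cAB: "coeff (A * [:1, 1:] ^ (n - 1)) (2 * n - 2) = (-1) ^ n * x"
    unfolding degAB .
  have c: "coeff (P_poly n x y z) (2 * n - 2) = (-1) ^ n * x"
    using n cAB by (simp add: P_poly_altdef A_def)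
  have "degree (P_poly n x y z) \<le> 2 * n - 2"
    unfolding P_poly_altdef A_def[symmetric]
    using degAB n degree_monom_le[of z "n - 1"] by (intro degree_diff_le) auto
  moreover have "degree (P_poly n x y z) \<ge> 2 * n - 2"
    using c x by (intro le_degree) auto
  ultimately show deg: "degree (P_poly n x y z) = 2 * n - 2" by simp
  show "lead_coeff (P_poly n x y z) = (-1) ^ n * x" using c by (simp add: deg)
qed

lemma poly_P_poly:
  "poly (P_poly n x y z) t =
    (-1) ^ n * (x * t ^ (n - 1) + y) * (1 + t) ^ (n - 1) - z * t ^ (n - 1)"
  by (simp add: P_poly_altdef poly_monom algebra_simps)

text \<open>Substituting y = x t^n turns x t^(n-1) + y into x t^(n-1) (1+t), which supplies the
  missing factor 1+t.\<close>

lemma poly_P_poly_critical: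
  fixes x y z :: "'a :: field"
  assumes n: "n \<ge> 1" and t: "t \<noteq> 0" "x * t ^ n = y"
  shows "poly (P_poly n x y z) t = t ^ (n - 1) * ((-1) ^ n * x * (1 + t) ^ n - z)"
proof -
  obtain k where "n = Suc k" using n by (cases n) auto
  then show ?thesis using t by (simp add: poly_P_poly algebra_simps)
qed

text \<open>The last summand is \<open>T^n * g'(T)\<close> for \<open>g = P / T^(n - 1)\<close>.\<close>

lemma P_poly_pderiv:
  fixes x y z :: "'a :: idom"
  assumes n: "n \<ge> 2"
  shows "t * poly (pderiv (P_poly n x y z)) t = of_nat (n - 1) * poly (P_poly n x y z) t +
    (-1) ^ n * of_nat (n - 1) * (1 + t) ^ (n - 2) * (x * t ^ n - y)"
proof -
  obtain k where k: "n = k + 2" using n by (metis le_add_diff_inverse2)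
  have "poly (pderiv (P_poly n x y z)) t =
      (-1) ^ n * x * of_nat (k + 1) * t ^ k * (1 + t) ^ (k + 1)
      + (-1) ^ n * (x * t ^ (k + 1) + y) * (of_nat (k + 1) * (1 + t) ^ k) - of_nat (k + 1) * z * t ^ k"
    unfolding P_poly_altdef
    by (simp add: k pderiv_mult pderiv_smult pderiv_diff pderiv_add pderiv_monom poly_monom pderiv_power_Suc pderiv_pCons
        algebra_simps del: power_Suc of_nat_Suc)
  then show ?thesis
    unfolding poly_P_poly by (simp only:) (simp add: k algebra_simps)
qed

text \<open>The inner product depends on b only through (-b)^n, so b may be replaced by \<epsilon>^r
  b. Then \<epsilon>^r multiplies a + \<epsilon>^s b as a whole, and the product over r can be
  evaluated first. The right side has the shape in which P appears at the solutions of x t^n = y;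
  the outer sign comes from reversing n differences.\<close>

lemma prod_unity_roots_swap:
  assumes n: "n > 0" and \<epsilon>: "primitive_unity_root n \<epsilon>"
  shows "(\<Prod>r=1..n. \<Prod>s=1..n. c + \<epsilon> ^ r * a + \<epsilon> ^ s * b) =
    (-1) ^ n * (\<Prod>s=1..n. (-1) ^ n * (a + \<epsilon> ^ s * b) ^ n - c ^ n)"
proof -
  have \<epsilon>n: "(\<epsilon> ^ r) ^ n = 1" for r
    using \<epsilon> by (metis mult.commute power_mult power_one primitive_unity_root_def)
  have "(\<Prod>s=1..n. c + \<epsilon> ^ r * a + \<epsilon> ^ s * b) = (\<Prod>s=1..n. c + \<epsilon> ^ r * (a + \<epsilon> ^ s * b))" for r
  proof -
    have "(- (\<epsilon> ^ r * b)) ^ n = (\<epsilon> ^ r * (- b)) ^ n" by simp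
    also have "\<dots> = (- b) ^ n" by (simp only: power_mult_distrib \<epsilon>n mult_1)
    finally have "(\<Prod>s=1..n. c + \<epsilon> ^ r * a + \<epsilon> ^ s * b) =
        (\<Prod>s=1..n. c + \<epsilon> ^ r * a + \<epsilon> ^ s * (\<epsilon> ^ r * b))"
      unfolding prod_unity_roots[OF n \<epsilon>] by (simp only:)
    then show ?thesis by (simp add: algebra_simps)
  qed
  then have "(\<Prod>r=1..n. \<Prod>s=1..n. c + \<epsilon> ^ r * a + \<epsilon> ^ s * b) =
      (\<Prod>s=1..n. \<Prod>r=1..n. c + \<epsilon> ^ r * (a + \<epsilon> ^ s * b))"
    by (simp only:) (rule prod.swap)
  also have "\<dots> = (\<Prod>s=1..n. (-1) * ((-1) ^ n * (a + \<epsilon> ^ s * b) ^ n - c ^ n))"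
    unfolding prod_unity_roots[OF n \<epsilon>]
    by (intro prod.cong refl, subst power_minus) simp
  also have "\<dots> = (-1) ^ n * (\<Prod>s=1..n. (-1) ^ n * (a + \<epsilon> ^ s * b) ^ n - c ^ n)"
    by (simp only: prod.distrib) simp
  finally show ?thesis .
qed

text \<open>The resultant of f and h is computed twice, over the roots of f (\<open>res1\<close>)
  and over the roots of h (\<open>res2\<close>), and the results are compared.\<close>

theorem resultant_P_poly:
  fixes a b c :: complex
  assumes n: "n \<ge> 2" and \<epsilon>: "primitive_unity_root n \<epsilon>" and a: "a \<noteq> 0" and b: "b \<noteq> 0"
  defines "f \<equiv> P_poly n (a ^ n) (b ^ n) (c ^ n)"
  shows "resultant f (pderiv f) = (-1) ^ n * a ^ n * ((-1) ^ (n - 1) * of_nat (n - 1) ^ (2 * n - 2)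
    * (a ^ n * b ^ n * c ^ n) ^ (n - 2) * (\<Prod>r=1..n. \<Prod>s=1..n. c + \<epsilon> ^ r * a + \<epsilon> ^ s * b))"
proof -
  define x y z where xyz: "x = a ^ n" "y = b ^ n" "z = c ^ n"
  define \<sigma> where "\<sigma> = (-1 :: complex) ^ n"
  define p where "p = (\<Prod>r=1..n. \<Prod>s=1..n. c + \<epsilon> ^ r * a + \<epsilon> ^ s * b)"
  define \<beta> where "\<beta> k = \<epsilon> ^ k * (b / a)" for k
  have x: "x \<noteq> 0" and y: "y \<noteq> 0" using a b by (auto simp: xyz)
  have n0: "n > 0" using n by simp
  have f: "f = P_poly n x y z" by (simp add: f_def xyz)
  have deg_f: "degree f = 2 * n - 2" and lc_f: "lead_coeff f = \<sigma> * x"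
    unfolding f \<sigma>_def using degree_P_poly[OF n x] lead_coeff_P_poly[OF n x] by auto
  have \<sigma>0: "\<sigma> \<noteq> 0" by (simp add: \<sigma>_def)
  obtain as where as: "f = smult (\<sigma> * x) (\<Prod>a\<leftarrow>as. [:- a, 1:])"
    using linear_factorization[of f] lc_f by auto
  have len: "length as = 2 * n - 2"
    using deg_f \<sigma>0 x degree_prod_linear[of as] unfolding as by simp
  have root: "poly f t = 0" if "t \<in> set as" for t
    using that by (auto simp: as poly_prod_linear' prod_list_zero_iff)
  \<comment> \<open>The product of the roots is read off the constant term; the number of roots,
    2n-2, is even, so no sign appears.\<close>
  have "poly f 0 = \<sigma> * x * (\<Prod>a\<leftarrow>as. (-1) * a)"
    by (simp add: as poly_prod_linear')
  also have "\<dots> = \<sigma> * x * prod_list as"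
    unfolding prod_list_const_mult len by simp
  finally have prod_as: "\<sigma> * x * prod_list as = \<sigma> * y"
    using n by (simp add: f poly_P_poly \<sigma>_def power_0_left)

  \<comment> \<open>The roots of h with multiplicity: -1 from (1+T)^(n-2), and
    \<open>\<beta> k\<close>, the solutions of x t^n = y.\<close>
  define bs where "bs = replicate (n - 2) (-1) @ map \<beta> [1..<Suc n]"
  define e where "e = \<sigma> * of_nat (n - 1) * x"
  define h where "h = smult e (\<Prod>b\<leftarrow>bs. [:- b, 1:])"
  have e: "e \<noteq> 0" using \<sigma>0 x n by (simp add: e_def)
  have list_prod: "(\<Prod>k\<leftarrow>[1..<Suc n]. g k) = (\<Prod>k=1..n. g k)" for g :: "nat \<Rightarrow> complex"
    by (subst prod.distinct_set_conv_list[symmetric]) (auto simp: atLeastLessThanSuc_atLeastAtMost simp del: upt_Suc)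
  have poly_h: "poly h t = \<sigma> * of_nat (n - 1) * (1 + t) ^ (n - 2) * (x * t ^ n - y)" for t
  proof -
    have "(\<Prod>k=1..n. t - \<beta> k) = (\<Prod>k=1..n. t + \<epsilon> ^ k * (- (b / a)))"
      by (simp add: \<beta>_def)
    also have "\<dots> = t ^ n - y / x"
      unfolding prod_unity_roots[OF n0 \<epsilon>] by (simp add: xyz power_divide)
    finally have prod_\<beta>: "(\<Prod>k=1..n. t - \<beta> k) = t ^ n - y / x" .
    have "x * (\<Prod>k=1..n. t - \<beta> k) = x * t ^ n - y"
      unfolding prod_\<beta> using x by (simp add: right_diff_distrib)
    moreover have "poly h t = e * (\<Prod>b\<leftarrow>bs. t - b)"
      by (simp add: h_def poly_prod_linear')
    then have "poly h t = e * ((1 + t) ^ (n - 2) * (\<Prod>k=1..n. t - \<beta> k))"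
      by (simp add: bs_def o_def list_prod[unfolded One_nat_def] add.commute del: upt_Suc)
    ultimately show ?thesis by (simp add: e_def)
  qed
  have len_bs: "length bs = 2 * n - 2" using n by (simp add: bs_def)
  then have deg_h: "degree h = 2 * n - 2"
    using e degree_prod_linear[of bs] by (simp add: h_def)
  have deg_f': "degree (pderiv f) = 2 * n - 3" by (simp add: degree_pderiv deg_f)

  have h_root: "poly h t = t * poly (pderiv f) t" if "t \<in> set as" for t
    using P_poly_pderiv[OF n, of t x y z] root[OF that] by (simp add: poly_h f \<sigma>_def)
  have "resultant f h = (\<sigma> * x) ^ (2 * n - 2) * (\<Prod>t\<leftarrow>as. poly h t)"
    using resultant_eq_prod_roots[OF as] \<sigma>0 x by (simp add: deg_h)
  also have "map (poly h) as = map (\<lambda>t. t * poly (pderiv f) t) as" using h_root by simp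
  also have "(\<Prod>t\<leftarrow>as. t * poly (pderiv f) t) = prod_list as * (\<Prod>t\<leftarrow>as. poly (pderiv f) t)"
    by (simp add: prod_list_multf)
  \<comment> \<open>The degree of h exceeds that of f' by one; the spare leading coefficient joins
    the product of the roots to form f(0) = \<sigma> y.\<close>
  also have "2 * n - 2 = Suc (2 * n - 3)" using n by simp
  also have "(\<sigma> * x) ^ Suc (2 * n - 3) * (prod_list as * (\<Prod>t\<leftarrow>as. poly (pderiv f) t))
      = (\<sigma> * x * prod_list as) * ((\<sigma> * x) ^ (2 * n - 3) * (\<Prod>t\<leftarrow>as. poly (pderiv f) t))"
    by simp
  also have "\<dots> = \<sigma> * y * resultant f (pderiv f)"
    using resultant_eq_prod_roots[OF as, of "pderiv f"] \<sigma>0 x unfolding prod_as deg_f' by simp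
  finally have res1: "resultant f h = \<sigma> * y * resultant f (pderiv f)" .

  have "even ((2 * n - 2) * (2 * n - 2))" by simp
  then have "resultant f h = resultant h f"
    using resultant_swap[of f h] by (simp add: deg_f deg_h)
  also have "\<dots> = e ^ (2 * n - 2) * (\<Prod>t\<leftarrow>bs. poly f t)"
    using resultant_eq_prod_roots[OF h_def e, of f] by (simp add: deg_f)
  also have "(\<Prod>t\<leftarrow>bs. poly f t) = poly f (-1) ^ (n - 2) * (\<Prod>k=1..n. poly f (\<beta> k))"
    by (simp add: bs_def o_def list_prod[unfolded One_nat_def] del: upt_Suc)
  also have "poly f (-1) = \<sigma> * z"
    using n by (cases n) (auto simp: f poly_P_poly \<sigma>_def power_0_left)
  also have "(\<Prod>k=1..n. poly f (\<beta> k)) = (- \<sigma> * (y / x)) ^ (n - 1) * (\<sigma> * p)"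
  proof -
    have "poly f (\<beta> k) = \<beta> k ^ (n - 1) * (\<sigma> * (a + \<epsilon> ^ k * b) ^ n - z)" for k
    proof -
      have "\<epsilon> ^ n = 1" using \<epsilon> by (simp add: primitive_unity_root_def)
      then have "\<epsilon> \<noteq> 0" and "(\<epsilon> ^ k) ^ n = 1"
        using n by (auto simp: power_0_left) (metis mult.commute power_mult power_one)
      then have "\<beta> k \<noteq> 0" "x * \<beta> k ^ n = y"
        using a b by (simp_all add: \<beta>_def xyz power_mult_distrib power_divide)
      moreover have "x * (1 + \<beta> k) ^ n = (a + \<epsilon> ^ k * b) ^ n"
        using a by (simp add: xyz \<beta>_def algebra_simps flip: power_mult_distrib)
      ultimately show ?thesis
        using n poly_P_poly_critical[of n "\<beta> k" x y z] by (simp add: f \<sigma>_def mult.assoc)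
    qed
    then have "(\<Prod>k=1..n. poly f (\<beta> k)) =
        (\<Prod>k=1..n. \<beta> k) ^ (n - 1) * (\<Prod>k=1..n. \<sigma> * (a + \<epsilon> ^ k * b) ^ n - z)"
      by (simp add: prod.distrib prod_power_distrib)
    \<comment> \<open>\<open>prod_unity_roots\<close> at w = 0. Its minus sign, raised to the power
      n-1, is the sign (-1)^(n-1) of the final formula.\<close>
    moreover have "(\<Prod>k=1..n. \<beta> k) = - \<sigma> * (y / x)"
      using prod_unity_roots[OF n0 \<epsilon>, of 0 "b / a"] n
      by (simp add: \<beta>_def \<sigma>_def xyz power_0_left power_minus[of "b / a"] power_divide)
    moreover have "(\<Prod>k=1..n. \<sigma> * (a + \<epsilon> ^ k * b) ^ n - z) = \<sigma> * p"
      unfolding p_def prod_unity_roots_swap[OF n0 \<epsilon>] \<sigma>_def xyz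
      by (simp flip: power_add mult.assoc)
    ultimately show ?thesis by simp
  qed
  finally have res2: "resultant f h =
    e ^ (2 * n - 2) * ((\<sigma> * z) ^ (n - 2) * ((- \<sigma> * (y / x)) ^ (n - 1) * (\<sigma> * p)))" .

  obtain k where k: "n = k + 2" using n by (metis le_add_diff_inverse2)
  define M where "M = (of_nat (n - 1) :: complex)"
  have "\<sigma> * y * resultant f (pderiv f) =
      \<sigma> * y * (\<sigma> * x * ((-1) ^ (n - 1) * M ^ (2 * n - 2) * (x * y * z) ^ (n - 2) * p))"
  proof -
    \<comment> \<open>The exponents have the parity of n or of n-1, so all powers of \<sigma> are
      settled by the parity of k = n-2.\<close>
    have sg: "\<sigma> = 1 \<and> even k \<or> \<sigma> = -1 \<and> odd k" by (cases "even k") (auto simp: \<sigma>_def k)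
    have *: "2 * n - 2 = (k + 1) + (k + 1)" "n - 2 = k" "n - 1 = k + 1" by (simp_all add: k)
    show ?thesis
      using sg x unfolding res1[symmetric] res2 e_def
      unfolding M_def[symmetric]
      unfolding *
      by (auto simp: power_mult_distrib power_add power_divide field_simps)
  qed
  then have "resultant f (pderiv f) =
      \<sigma> * x * ((-1) ^ (n - 1) * M ^ (2 * n - 2) * (x * y * z) ^ (n - 2) * p)"
    using \<sigma>0 y by simp
  then show ?thesis unfolding p_def \<sigma>_def xyz M_def .
qed


section \<open>Homogeneous polynomials\<close>

text \<open>\<open>A d\<close> stands for the homogeneous elements of degree d, zero included.
  Stating the closure rules abstractly lets one set of lemmas serve both binary and ternary
  forms.\<close>

locale grading =
  fixes A :: "nat \<Rightarrow> 'a :: comm_ring_1 set"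
  assumes zero: "0 \<in> A d"
    and add: "a \<in> A d \<Longrightarrow> b \<in> A d \<Longrightarrow> a + b \<in> A d"
    and uminus: "a \<in> A d \<Longrightarrow> - a \<in> A d"
    and one: "1 \<in> A 0"
    and mult: "a \<in> A d \<Longrightarrow> b \<in> A e \<Longrightarrow> a * b \<in> A (d + e)"
begin

lemma diff: "a \<in> A d \<Longrightarrow> b \<in> A d \<Longrightarrow> a - b \<in> A d"
  using add[of a d "- b"] uminus[of b d] by simp

lemma sum: "(\<And>i. i \<in> I \<Longrightarrow> f i \<in> A d) \<Longrightarrow> (\<Sum>i\<in>I. f i) \<in> A d"
  by (induction I rule: infinite_finite_induct) (auto intro: zero add)

lemma prod: "finite I \<Longrightarrow> (\<And>i. i \<in> I \<Longrightarrow> f i \<in> A d) \<Longrightarrow> (\<Prod>i\<in>I. f i) \<in> A (card I * d)"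
  by (induction I rule: finite_induct) (auto intro: one mult)

lemma power: "a \<in> A d \<Longrightarrow> a ^ k \<in> A (k * d)"
  by (induction k) (auto intro: one mult)

lemma of_nat: "of_nat k \<in> A 0"
  by (induction k) (auto intro: zero one add)

text \<open>Every term of the Leibniz expansion is, up to sign, a product of k entries of degree
  d.\<close>

lemma det:
  assumes "M \<in> carrier_mat k k" "\<And>i j. i < k \<Longrightarrow> j < k \<Longrightarrow> M $$ (i, j) \<in> A d"
  shows "det M \<in> A (k * d)"
proof -
  have "signof p * (\<Prod>i=0..<k. M $$ (i, p i)) \<in> A (k * d)" if p: "p permutes {0..<k}" for p
  proof -
    have "p i < k" if "i < k" for i using permutes_in_image[OF p, of i] that by simp
    then have "(\<Prod>i=0..<k. M $$ (i, p i)) \<in> A (k * d)"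
      using prod[of "{0..<k}"] assms(2) by simp
    then show ?thesis by (auto simp: sign_def intro: uminus)
  qed
  then show ?thesis using assms(1) by (auto simp: det_def' intro: sum)
qed

end

definition const_grade :: "nat \<Rightarrow> 'a :: comm_ring_1 set" where
  "const_grade d = (if d = 0 then UNIV else {0})"

text \<open>Adjoins a variable of weight 1 to a graded ring. Iterated from
  \<open>const_grade\<close>, it describes the forms inside the nested polynomial types.\<close>

definition poly_grade :: "(nat \<Rightarrow> 'a :: comm_ring_1 set) \<Rightarrow> nat \<Rightarrow> 'a poly set" where
  "poly_grade A d = {p. \<forall>i. if i \<le> d then coeff p i \<in> A (d - i) else coeff p i = 0}"

lemma grading_const: "grading const_grade"
  by unfold_locales (auto simp: const_grade_def split: if_splits)

lemma grading_poly:
  assumes "grading A"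
  shows "grading (poly_grade A)"
proof -
  interpret grading A by fact
  show ?thesis
  proof
    fix p q d e assume p: "p \<in> poly_grade A d" and q: "q \<in> poly_grade A e"
    have "coeff p i * coeff q (k - i) \<in> A (d + e - k)" if "i \<le> k" "k \<le> d + e" for i k
    \<comment> \<open>The truncated differences add up to d + e - k only when both indices are in
      range; otherwise one factor vanishes.\<close>
    proof (cases "i \<le> d \<and> k - i \<le> e")
      case True
      then have "coeff p i * coeff q (k - i) \<in> A ((d - i) + (e - (k - i)))"
        using p q by (intro mult) (auto simp: poly_grade_def)
      moreover have "(d - i) + (e - (k - i)) = d + e - k" using True that by linarith
      ultimately show ?thesis by simp
    next
      case False
      then have "coeff p i = 0 \<or> coeff q (k - i) = 0" using p q by (auto simp: poly_grade_def)
      then show ?thesis by (auto simp: zero)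
    qed
    moreover have "coeff p i * coeff q (k - i) = 0" if "i \<le> k" "k > d + e" for i k
    proof -
      have "i > d \<or> k - i > e" using that by auto
      then show ?thesis using p q by (auto simp: poly_grade_def)
    qed
    ultimately show "p * q \<in> poly_grade A (d + e)"
      by (auto simp: poly_grade_def coeff_mult intro: sum sum.neutral)
  qed (auto simp: poly_grade_def zero add uminus one coeff_1)
qed

lemma poly_grade_var: "grading A \<Longrightarrow> [:0, 1:] \<in> poly_grade A 1"
  by (auto simp: poly_grade_def coeff_pCons grading.zero grading.one split: nat.split)

lemma poly_grade_const: "grading A \<Longrightarrow> a \<in> A d \<Longrightarrow> [:a:] \<in> poly_grade A d"
  by (auto simp: poly_grade_def coeff_pCons grading.zero split: nat.split)

abbreviation "binary_form \<equiv> poly_grade (poly_grade const_grade)"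
abbreviation "ternary_form \<equiv> poly_grade (poly_grade (poly_grade const_grade))"

lemma grading_binary: "grading binary_form" and grading_ternary: "grading ternary_form"
  by (intro grading_poly grading_const)+

lemma poly_gradeD:
  assumes "p \<in> poly_grade A d" "coeff p i \<noteq> 0"
  shows "i \<le> d" "coeff p i \<in> A (d - i)"
proof -
  have "if i \<le> d then coeff p i \<in> A (d - i) else coeff p i = 0"
    using assms(1) unfolding poly_grade_def by blast
  then show "i \<le> d" "coeff p i \<in> A (d - i)"
    using assms(2) by (auto split: if_splits)
qed

lemma ternary_form_coeff:
  assumes "F \<in> ternary_form d" "coeff (coeff (coeff F k) j) i \<noteq> 0"
  shows "i + j + k = d"
proof -
  have nz: "coeff F k \<noteq> 0" "coeff (coeff F k) j \<noteq> 0" using assms(2) by auto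
  note k = poly_gradeD[OF assms(1) nz(1)]
  note j = poly_gradeD[OF k(2) nz(2)]
  note i = poly_gradeD[OF j(2) assms(2)]
  show ?thesis using k(1) j(1) i assms(2) by (auto simp: const_grade_def split: if_splits)
qed

text \<open>All monomials that occur have degree d, and F \<noteq> 0 supplies at least one, so the
  set under \<open>Max\<close> is the singleton of d apart from the inserted 0.\<close>

lemma total_degree_ternary_form:
  assumes "F \<in> ternary_form d" "F \<noteq> 0"
  shows "total_degree_xyz F = d"
proof -
  obtain i j k where "coeff (coeff (coeff F k) j) i \<noteq> 0"
    using leading_coeff_neq_0[OF leading_coeff_neq_0[OF leading_coeff_neq_0[OF \<open>F \<noteq> 0\<close>]]]
    by (rule that)
  then have "{i + j + k | i j k. coeff (coeff (coeff F k) j) i \<noteq> 0} = {d}"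
    using ternary_form_coeff[OF assms(1)] by blast
  then show ?thesis by (simp add: total_degree_xyz_def)
qed

lemma ternary_form_vars: "X \<in> ternary_form 1" "Y \<in> ternary_form 1" "Z \<in> ternary_form 1"
  unfolding X_def Y_def Z_def
  by (intro poly_grade_const poly_grade_var grading_poly grading_const)+

text \<open>Homogeneity leaves only the power v^(d-i) next to u^i, so setting v = 1 loses no
  information about a form of known degree.\<close>

lemma binary_form_coeff:
  assumes "F \<in> binary_form d"
  shows "coeff F i = (if i \<le> d then monom (poly (coeff F i) 1) (d - i) else 0)"
proof (cases "i \<le> d")
  case True
  define q where "q = coeff F i"
  have q: "q \<in> poly_grade const_grade (d - i)"
    using assms True unfolding q_def poly_grade_def[of "poly_grade const_grade"] by auto
  have "coeff q j = 0" if "j \<noteq> d - i" for j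
  proof (rule ccontr)
    assume nz: "coeff q j \<noteq> 0"
    note j = poly_gradeD[OF q this]
    then have "d - i - j = 0" using nz by (auto simp: const_grade_def split: if_splits)
    then show False using j(1) that by simp
  qed
  then have q_monom: "q = monom (coeff q (d - i)) (d - i)" by (intro poly_eqI) auto
  then have "poly q 1 = coeff q (d - i)" by (metis mult.right_neutral poly_monom power_one)
  then show ?thesis using True q_monom by (simp add: q_def)
qed (use assms in \<open>auto simp: poly_grade_def\<close>)

lemma comm_ring_hom_poly_1: "comm_ring_hom (\<lambda>q. poly q (1 :: 'a :: comm_ring_1))"
  by unfold_locales auto

lemma dehomogenise_pderiv: "dehomogenise (pderiv F) = pderiv (dehomogenise F)"
  by (intro poly_eqI) (simp add: dehomogenise_def coeff_map_poly coeff_pderiv algebra_simps)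

text \<open>Euler's identity \<open>u F\<^sub>u + v F\<^sub>v = d F\<close> at \<open>v = 1\<close>.\<close>

lemma dehomogenise_map_pderiv:
  fixes F :: "'a :: idom poly poly"
  assumes "F \<in> binary_form d"
  shows "dehomogenise (map_poly pderiv F) =
    smult (of_nat d) (dehomogenise F) - [:0, 1:] * pderiv (dehomogenise F)"
proof (intro poly_eqI)
  fix i
  have "poly (pderiv (coeff F i)) 1 = (of_nat d - of_nat i) * poly (coeff F i) 1"
    by (subst (1 2) binary_form_coeff[OF assms])
      (auto simp: pderiv_monom poly_monom of_nat_diff)
  then show "coeff (dehomogenise (map_poly pderiv F)) i =
      coeff (smult (of_nat d) (dehomogenise F) - [:0, 1:] * pderiv (dehomogenise F)) i"
    by (cases i) (auto simp: dehomogenise_def coeff_map_poly coeff_pderiv algebra_simps)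
qed

lemma P_form_binary: 
  assumes "n \<ge> 1"
  shows "P_form n x y z \<in> binary_form (2 * n - 2)"
proof -
  interpret grading "binary_form :: nat \<Rightarrow> 'a poly poly set" by (rule grading_binary)
  define m where "m = n - 1"
  have c: "[:[:a:]:] \<in> binary_form 0" for a :: 'a
    by (intro poly_grade_const grading_poly grading_const) (auto simp: const_grade_def)
  have u: "[:0, 1:] \<in> (binary_form 1 :: 'a poly poly set)" and v: "[:[:0, 1:]:] \<in> (binary_form 1 :: 'a poly poly set)"
    by (intro poly_grade_const poly_grade_var grading_poly grading_const)+
  have "([:0, 1:] + [:[:0, 1:]:]) ^ m * ([:[:x:]:] * [:0, 1:] ^ m + [:[:y:]:] * [:[:0, 1:]:] ^ m)
     - ([:0, 1:] * [:[:0, 1:]:]) ^ m * [:[:z:]:] \<in> binary_form (m + m)"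
    using mult[OF power[OF add[OF u v]] add[OF mult[OF c power[OF u]] mult[OF c power[OF v]]]]
      mult[OF power[OF mult[OF u v]] c]
    by (intro diff) (simp_all add: mult_2_right)
  moreover have "2 * n - 2 = m + m" by (simp add: m_def)
  ultimately show ?thesis unfolding P_form_def Let_def m_def by simp
qed

lemma dehomogenise_P_form:
  "dehomogenise (P_form n x y z) =
    (1 + [:0, 1:]) ^ (n - 1) * (smult x ([:0, 1:] ^ (n - 1)) + [:y:]) - smult z ([:0, 1:] ^ (n - 1))"
proof -
  interpret h: comm_ring_hom "\<lambda>q. poly q (1 :: 'a)" by (rule comm_ring_hom_poly_1)
  interpret m: map_poly_comm_ring_hom "\<lambda>q. poly q (1 :: 'a)" ..
  define T where "T = [:0, 1 :: 'a:]"
  have u: "map_poly (\<lambda>q. poly q (1 :: 'a)) [:0, 1:] = T"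
    and v: "map_poly (\<lambda>q. poly q (1 :: 'a)) [:[:0, 1:]:] = 1"
    by (simp_all add: map_poly_pCons pCons_one T_def)
  have w: "map_poly (\<lambda>q. poly q (1 :: 'a)) [:[:w:]:] = [:w:]" for w
    by (intro poly_eqI) (simp add: coeff_map_poly coeff_pCons split: nat.split)
  have "dehomogenise (P_form n x y z) =
      (T + 1) ^ (n - 1) * ([:x:] * T ^ (n - 1) + [:y:] * 1 ^ (n - 1)) - (T * 1) ^ (n - 1) * [:z:]"
    unfolding dehomogenise_def P_form_def Let_def
    by (simp only: m.hom_add m.hom_mult m.hom_minus m.hom_power u v w)
  then show ?thesis
    unfolding T_def[symmetric] by (simp add: add.commute)
qed

section \<open>Homogeneity and nonvanishing of p_n\<close>

text \<open>Replaces the description by \<open>THE\<close> with an explicit determinant, from which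
  homogeneity can be read off.\<close>

lemma p_poly_eq_det:
  assumes n: "n > 0"
  shows "p_poly n = det (p_mat n X Y Z)"
proof -
  have "eval_xyz (det (p_mat n X Y Z)) x y z = det (p_mat n x y z)" for x y z
  proof -
    interpret comm_ring_hom "\<lambda>F. eval_xyz F x y z" by (rule comm_ring_hom_eval_xyz)
    have "map_mat (\<lambda>F. eval_xyz F x y z) (p_mat n X Y Z) = p_mat n x y z"
      by (intro eq_matI) (auto simp: p_mat_def hom_distribs)
    then show ?thesis by (simp flip: hom_det)
  qed
  then have "is_p n (det (p_mat n X Y Z))"
    by (simp add: is_p_def det_p_mat[OF n])
  then show ?thesis
    unfolding p_poly_def using ex1_is_p[OF n] by (simp add: the1_equality)
qed

lemma is_p_p_poly: "n > 0 \<Longrightarrow> is_p n (p_poly n)"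
  unfolding p_poly_def by (rule theI'[OF ex1_is_p])

lemma p_poly_ternary_form:
  assumes n: "n > 0"
  shows "p_poly n \<in> ternary_form n"
proof -
  interpret grading ternary_form by (rule grading_ternary)
  have c: "of_nat k * F \<in> ternary_form (Suc 0)" if "F \<in> ternary_form (Suc 0)" for k F
    using mult[OF of_nat that] by simp
  have s: "(-1) ^ k * F \<in> ternary_form (Suc 0)" if "F \<in> ternary_form (Suc 0)" for k F
    using that by (cases "even k") (auto intro: uminus)
  have "p_mat n X Y Z \<in> carrier_mat n n" by (simp add: p_mat_def)
  moreover have "p_mat n X Y Z $$ (i, j) \<in> ternary_form 1" if "i < n" "j < n" for i j
    using that ternary_form_vars by (auto simp: p_mat_def intro!: c s add diff)
  ultimately show ?thesis
    unfolding p_poly_eq_det[OF n] using det[of "p_mat n X Y Z" n 1] by simp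
qed

text \<open>At a = b = 0, c = 1 every factor of the defining product is 1.\<close>

lemma p_poly_nonzero:
  assumes n: "n > 0"
  shows "p_poly n \<noteq> 0"
proof
  assume "p_poly n = 0"
  moreover have "eval_xyz (p_poly n) (0 ^ n) (0 ^ n) (1 ^ n) = 1"
    using is_p_p_poly[OF n, unfolded is_p_def, rule_format, OF primitive_unity_root_cis[OF n], of 0 0 1]
    by simp
  ultimately show False by (simp add: eval_xyz_def)
qed

section \<open>Transfer to polynomials in x, y, z\<close>

lemma map_poly_P_poly:
  assumes "comm_ring_hom h"
  shows "map_poly h (P_poly n x y z) = P_poly n (h x) (h y) (h z)"
proof -
  interpret comm_ring_hom h by fact
  interpret m: map_poly_comm_ring_hom h ..
  have c: "map_poly h [:w:] = [:h w:]" for w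
    by (intro poly_eqI) (simp add: coeff_map_poly coeff_pCons split: nat.split)
  have t: "map_poly h [:1, 1:] = [:1, 1:]"
    by (intro poly_eqI) (simp add: coeff_map_poly coeff_pCons split: nat.split)
  have mon: "map_poly h (monom w k) = monom (h w) k" for w k
    by (intro poly_eqI) (simp add: coeff_map_poly)
  show ?thesis
    unfolding P_poly_altdef
    by (simp only: m.hom_add m.hom_mult m.hom_minus m.hom_power c t mon)
      (simp only: hom_mult hom_power hom_uminus hom_one)
qed

lemma resultant_sub_hom:
  assumes "comm_ring_hom h"
  shows "resultant_sub m n (map_poly h f) (map_poly h g) = h (resultant_sub m n f g)"
proof -
  interpret comm_ring_hom h by fact
  show ?thesis
    unfolding resultant_sub_def by (subst sylvester_mat_sub_map[symmetric]) simp_all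
qed

lemma dehomogenise_P_form_P_poly:
  "dehomogenise (P_form n x y ((-1) ^ n * z)) = smult ((-1) ^ n) (P_poly n x y z)"
proof -
  define T where "T = [:0, 1 :: 'a:]"
  show ?thesis
    unfolding dehomogenise_P_form P_poly_def Let_def T_def[symmetric]
    by (cases "even n") (simp_all add: algebra_simps)
qed

lemma X_nonzero: "X \<noteq> 0" and Y_nonzero: "Y \<noteq> 0" and Z_nonzero: "Z \<noteq> 0"
  by (simp_all add: X_def Y_def Z_def)

text \<open>Evaluation commutes with the resultant when it preserves the degrees of both arguments;
  x \<noteq> 0 keeps the leading coefficient (-1)^n x of P alive, and with it that of the
  derivative.\<close>

lemma eval_xyz_resultant_P_poly:
  assumes n: "n \<ge> 2" and x: "x \<noteq> 0"
  shows "eval_xyz (resultant (P_poly n X Y Z) (pderiv (P_poly n X Y Z))) x y z =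
    resultant (P_poly n x y z) (pderiv (P_poly n x y z))"
proof -
  note hom = comm_ring_hom_eval_xyz[of x y z]
  interpret comm_ring_hom "\<lambda>F. eval_xyz F x y z" by (rule hom)
  have map: "map_poly (\<lambda>F. eval_xyz F x y z) (P_poly n X Y Z) = P_poly n x y z"
    unfolding map_poly_P_poly[OF hom] by simp
  show ?thesis
    using resultant_map_poly[of "P_poly n X Y Z" "pderiv (P_poly n X Y Z)"]
    unfolding idom_hom.map_poly_pderiv[OF idom_hom.intro[OF hom]] map
    by (simp add: degree_pderiv degree_P_poly[OF n] x X_nonzero)
qed

theorem resultant_P_poly_xyz:
  assumes n: "n \<ge> 2"
  shows "resultant (P_poly n X Y Z) (pderiv (P_poly n X Y Z)) = (-1) ^ n * X *
    ((-1) ^ (n - 1) * (of_nat n - 1) ^ (2 * n - 2) * (X * Y * Z) ^ (n - 2) * p_poly n)"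
    (is "?R = ?S")
proof -
  \<comment> \<open>The factor X Y makes the claim trivial at points with x = 0 or y = 0, where the
    root computation does not apply; it is cancelled at the end in the integral domain of
    polynomials.\<close>
  have "eval_xyz (X * Y * (?R - ?S)) x y z = 0" for x y z
  proof -
    interpret comm_ring_hom "\<lambda>F. eval_xyz F x y z" by (rule comm_ring_hom_eval_xyz)
    show ?thesis
    proof (cases "x = 0 \<or> y = 0")
      case True
      then show ?thesis by (auto simp: hom_mult)
    next
      case False
      have "n > 0" using n by simp
      then obtain a b c where abc: "x = a ^ n" "y = b ^ n" "z = c ^ n"
        by (metis nth_root_exists)
      with False n have ab: "a \<noteq> 0" "b \<noteq> 0" by (auto simp: power_0_left)
      define \<epsilon> where "\<epsilon> = cis (2 * pi / real n)"
      have \<epsilon>: "primitive_unity_root n \<epsilon>"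
        unfolding \<epsilon>_def by (rule primitive_unity_root_cis) fact
      have p: "eval_xyz (p_poly n) x y z = (\<Prod>r=1..n. \<Prod>s=1..n. c + \<epsilon> ^ r * a + \<epsilon> ^ s * b)"
        unfolding abc using is_p_p_poly[OF \<open>n > 0\<close>] \<epsilon> unfolding is_p_def by blast
      have "eval_xyz ?R x y z = resultant (P_poly n x y z) (pderiv (P_poly n x y z))"
        using False by (intro eval_xyz_resultant_P_poly n) simp
      also have "\<dots> = (-1) ^ n * x * ((-1) ^ (n - 1) * of_nat (n - 1) ^ (2 * n - 2)
          * (x * y * z) ^ (n - 2) * eval_xyz (p_poly n) x y z)"
        unfolding p unfolding abc by (rule resultant_P_poly[OF n \<epsilon> ab])
      also have "of_nat (n - 1) = (of_nat n - 1 :: complex)" using n by (simp add: of_nat_diff)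
      also have "(-1) ^ n * x * ((-1) ^ (n - 1) * (of_nat n - 1) ^ (2 * n - 2)
          * (x * y * z) ^ (n - 2) * eval_xyz (p_poly n) x y z) = eval_xyz ?S x y z"
        by (simp only: hom_mult hom_power hom_minus hom_uminus hom_one hom_of_nat eval_xyz_vars)
      finally show ?thesis by (simp add: hom_mult hom_minus)
    qed
  qed
  then have "X * Y * (?R - ?S) = 0" by (rule eval_xyz_0_imp_0)
  then show ?thesis using X_nonzero Y_nonzero by simp
qed

text \<open>Division by the leading coefficient (-1)^n X. The case n = 2 shows the sign: for x T^2 +
  (x+y-z) T + y this normalisation gives 4xy - (x+y-z)^2, which is -p_2.\<close>

theorem disc_P_poly:
  assumes n: "n \<ge> 2"
  shows "disc (P_poly n X Y Z) =
    (-1) ^ (n - 1) * (of_nat n - 1) ^ (2 * n - 2) * (X * Y * Z) ^ (n - 2) * p_poly n"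
proof -
  have "(-1) ^ n * X \<noteq> 0" using X_nonzero by simp
  then show ?thesis
    unfolding disc_def lead_coeff_P_poly[OF n X_nonzero] resultant_P_poly_xyz[OF n]
    by (rule nonzero_mult_div_cancel_left)
qed

text \<open>The left side is a determinant of fixed size, so it commutes with evaluation at every
  point. Multiplying by X confines the comparison to x \<noteq> 0, where P keeps degree d and
  \<open>resultant_sub_pderiv\<close> applies.\<close>

theorem form_disc_P_form:
  assumes n: "n \<ge> 2"
  shows "form_disc (2 * n - 2) (P_form n X Y ((-1) ^ n * Z))
    = of_nat (2 * n - 2) ^ (2 * n - 4) * disc (P_poly n X Y Z)"
    (is "?L = _ * ?D")
proof -
  define d where "d = 2 * n - 2"
  have d: "d \<ge> 2" "2 * n - 2 = d" "2 * n - 4 = d - 2" using n by (auto simp: d_def)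
  have R: "resultant (P_poly n X Y Z) (pderiv (P_poly n X Y Z)) = (-1) ^ n * X * ?D"
    unfolding disc_P_poly[OF n] by (rule resultant_P_poly_xyz[OF n])
  have "eval_xyz (X * (?L - of_nat d ^ (d - 2) * ?D)) x y z = 0" for x y z
  proof (cases "x = 0")
    case False
    note hom = comm_ring_hom_eval_xyz[of x y z]
    interpret comm_ring_hom "\<lambda>F. eval_xyz F x y z" by (rule hom)
    interpret m: map_poly_comm_ring_hom "\<lambda>F. eval_xyz F x y z" ..
    define \<sigma> where "\<sigma> = (-1 :: complex) ^ n"
    have \<sigma>: "\<sigma> = 1 \<or> \<sigma> = -1" by (cases "even n") (auto simp: \<sigma>_def)
    define P where "P = P_poly n x y z"
    define f where "f = smult \<sigma> P"
    define q where "q = smult ((-1) ^ n) (P_poly n X Y Z)"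
    have degP: "degree P = d" and lcP: "lead_coeff P = \<sigma> * x"
      using degree_P_poly[OF n False] lead_coeff_P_poly[OF n False] by (auto simp: P_def \<sigma>_def d_def)
    have map_q: "map_poly (\<lambda>F. eval_xyz F x y z) q = f"
    proof -
      have "map_poly (\<lambda>F. eval_xyz F x y z) q =
          smult (eval_xyz ((-1) ^ n) x y z) (map_poly (\<lambda>F. eval_xyz F x y z) (P_poly n X Y Z))"
        unfolding q_def by (intro poly_eqI) (simp add: coeff_map_poly hom_mult)
      also have "eval_xyz ((-1) ^ n) x y z = \<sigma>"
        by (simp only: hom_power hom_uminus hom_one \<sigma>_def)
      finally show ?thesis unfolding map_poly_P_poly[OF hom] by (simp add: f_def P_def)
    qed
    have map_g: "map_poly (\<lambda>F. eval_xyz F x y z) (smult (of_nat d) q - [:0, 1:] * pderiv q)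
        = smult (of_nat d) f - [:0, 1:] * pderiv f"
    proof -
      have "map_poly (\<lambda>F. eval_xyz F x y z) (smult (of_nat d) q)
          = smult (of_nat d) (map_poly (\<lambda>F. eval_xyz F x y z) q)"
        by (intro poly_eqI) (simp add: coeff_map_poly hom_mult hom_of_nat)
      moreover have "map_poly (\<lambda>F. eval_xyz F x y z) [:0, 1:] = [:0, 1:]"
        by (intro poly_eqI) (simp add: coeff_map_poly coeff_pCons split: nat.split)
      ultimately show ?thesis
        by (simp only: m.hom_minus m.hom_mult idom_hom.map_poly_pderiv[OF idom_hom.intro[OF hom]] map_q)
    qed
    have "P_form n X Y ((-1) ^ n * Z) \<in> binary_form d"
      unfolding d_def using n by (intro P_form_binary) simp
    from dehomogenise_map_pderiv[OF this]
    have "?L = resultant_sub (d - 1) (d - 1) (pderiv q) (smult (of_nat d) q - [:0, 1:] * pderiv q)"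
      unfolding form_disc_def form_resultant_def dehomogenise_pderiv dehomogenise_P_form_P_poly
        q_def[symmetric] d(2) by (simp only:)
    then have "eval_xyz ?L x y z =
        resultant_sub (d - 1) (d - 1) (pderiv f) (smult (of_nat d) f - [:0, 1:] * pderiv f)"
      by (simp only: resultant_sub_hom[OF hom, symmetric] idom_hom.map_poly_pderiv[OF idom_hom.intro[OF hom]] map_q map_g)
    moreover have "degree f = d" "lead_coeff f = x"
      using \<sigma> degP lcP by (auto simp: f_def)
    ultimately have "x * eval_xyz ?L x y z = of_nat d ^ (d - 2) * resultant f (pderiv f)"
      using resultant_sub_pderiv[of f d] d(1) by simp
    also have "resultant f (pderiv f) = \<sigma> * resultant P (pderiv P)"
    proof -
      have \<sigma>0: "\<sigma> \<noteq> 0" using \<sigma> by auto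
      have "resultant f (pderiv f) = \<sigma> ^ (d - 1 + d) * resultant P (pderiv P)"
        unfolding f_def pderiv_smult resultant_smult_left[OF \<sigma>0] resultant_smult_right[OF \<sigma>0]
        using \<sigma>0 by (simp add: degree_pderiv degP power_add)
      \<comment> \<open>The exponent 2d-1 is odd and \<sigma> is 1 or -1.\<close>
      moreover have "\<sigma> ^ (d - 1 + d) = \<sigma>" using \<sigma> d(1) by (auto simp: d_def)
      ultimately show ?thesis by simp
    qed
    also have "resultant P (pderiv P) = \<sigma> * x * eval_xyz ?D x y z"
      unfolding P_def eval_xyz_resultant_P_poly[OF n False, symmetric] R
      by (simp only: hom_mult hom_power hom_uminus hom_one eval_xyz_vars \<sigma>_def)
    finally have "x * eval_xyz ?L x y z = x * (of_nat d ^ (d - 2) * eval_xyz ?D x y z)"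
      using \<sigma> by auto
    then show ?thesis
      using False by (simp add: hom_mult hom_minus hom_power hom_of_nat)
  next
    case True
    interpret comm_ring_hom "\<lambda>F. eval_xyz F x y z" by (rule comm_ring_hom_eval_xyz)
    show ?thesis unfolding hom_mult eval_xyz_vars using True by simp
  qed
  then have "X * (?L - of_nat d ^ (d - 2) * ?D) = 0" by (rule eval_xyz_0_imp_0)
  then show ?thesis using X_nonzero unfolding d by simp
qed

text \<open>In the closed formula (XYZ)^(n-2) contributes 3(n-2) and p_n contributes n; no factor is
  zero, so the degree of the form is its total degree.\<close>

theorem total_degree_disc_P_poly:
  assumes n: "n \<ge> 2"
  shows "total_degree_xyz (disc (P_poly n X Y Z)) = 4 * n - 6"
proof (rule total_degree_ternary_form)
  interpret grading "ternary_form :: nat \<Rightarrow> xyz_poly set" by (rule grading_ternary)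
  have n0: "n > 0" using n by simp
  \<comment> \<open>The degrees are left unevaluated so that they match the rules
    \<open>mult\<close> and \<open>power\<close> literally.\<close>
  have const: "(-1) ^ (n - 1) * (of_nat n - 1) ^ (2 * n - 2) \<in> (ternary_form (0 + (2 * n - 2) * 0) :: xyz_poly set)"
  proof (rule mult)
    show "(-1) ^ (n - 1) \<in> (ternary_form 0 :: xyz_poly set)" using power[OF uminus[OF one], of "n - 1"] by simp
    show "(of_nat n - 1) ^ (2 * n - 2) \<in> (ternary_form ((2 * n - 2) * 0) :: xyz_poly set)"
      by (intro power diff of_nat one)
  qed
  have "(X * Y * Z) ^ (n - 2) \<in> ternary_form ((n - 2) * (1 + 1 + 1))"
    by (intro power mult ternary_form_vars)
  from mult[OF mult[OF const this] p_poly_ternary_form[OF n0]]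
  have "disc (P_poly n X Y Z) \<in> ternary_form (0 + (2 * n - 2) * 0 + (n - 2) * (1 + 1 + 1) + n)"
    unfolding disc_P_poly[OF n] .
  moreover have "0 + (2 * n - 2) * 0 + (n - 2) * (1 + 1 + 1) + n = 4 * n - 6" using n by simp
  ultimately show "disc (P_poly n X Y Z) \<in> ternary_form (4 * n - 6)" by simp
  have "of_nat n - 1 = (of_nat (n - 1) :: xyz_poly)" using n by (simp add: of_nat_diff)
  then have "of_nat n - 1 \<noteq> (0 :: xyz_poly)" using n by simp
  then show "disc (P_poly n X Y Z) \<noteq> 0"
    unfolding disc_P_poly[OF n] using p_poly_nonzero[OF n0] X_nonzero Y_nonzero Z_nonzero by simp
qed

theorem theorem8:
  fixes n :: nat
  assumes "n \<ge> 2"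
  shows "total_degree_xyz (disc (P_poly n X Y Z)) = 4 * n - 6 \<and>
    (-1) ^ (n - 1) * (of_nat n - 1) ^ (2 * n - 2) * (X * Y * Z) ^ (n - 2) * p_poly n
      = disc (P_poly n X Y Z) \<and>
    form_disc (2 * n - 2) (P_form n X Y ((-1) ^ n * Z))
      = of_nat (2 * n - 2) ^ (2 * n - 4) * disc (P_poly n X Y Z)"
  using total_degree_disc_P_poly[OF assms] disc_P_poly[OF assms] form_disc_P_form[OF assms] by simp

end
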